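(* For every $\pi\in\mathfrak{B}_n$, $$\sum_{j,k\ge 0}\binom{\left\lceil \tfrac12\,(jk+j+k-1-\mathrm{fdes}(\pi))\right\rceil+n}{n}s^jt^k=\frac{F_\pi(s,t)}{(1-s)(1-s^2)^n(1-t)(1-t^2)^n},$$ where $$F_\pi(s,t)=\sum_{\sigma\tau=\pi}s^{\mathrm{fdes}(\sigma)}t^{\mathrm{fdes}(\tau)},$$ the sum being over all pairs $(\sigma,\tau)\in\mathfrak{B}_n\times\mathfrak{B}_n$ with $\sigma\tau=\pi$.
   Context: Let $n\ge 1$. The hyperoctahedral group $\mathfrak{B}_n$ is the group (under composition of functions, $(\sigma\tau)(i)=\sigma(\tau(i))$) of all bijections $\pi$ of $\{-n,\ldots,-1,0,1,\ldots,n\}$ with $\pi(-i)=-\pi(i)$ for all $i$; in particular $\pi(0)=0$. For $\pi\in\mathfrak{B}_n$, let $\mathrm{des}_A(\pi)$ be the number of $i\in\{1,\ldots,n-1\}$ with $\pi(i)>\pi(i+1)$, and let $\mathrm{des}_B(\pi)$ be the number of $i\in\{0,1,\ldots,n-1\}$ with $\pi(i)>\pi(i+1)$. The flag descent number is $\mathrm{fdes}(\pi)=\mathrm{des}_A(\pi)+\mathrm{des}_B(\pi)$. The identity is one of formal power series in $s,t$. *)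

theory Defs
  imports
    "HOL-Combinatorics.Permutations"
    "HOL-Computational_Algebra.Formal_Power_Series"
begin

(* Elements are functions on all of int that fix every point outside {-n..n}, so that each
   bijection of {-n..n} is represented exactly once and the group operation is function
   composition. *)
definition hyperoctahedral :: "nat \<Rightarrow> (int \<Rightarrow> int) set" where
  "hyperoctahedral n =
     {\<pi>. \<pi> permutes {- int n..int n} \<and> (\<forall>i\<in>{- int n..int n}. \<pi> (- i) = - \<pi> i)}"

definition des_A :: "nat \<Rightarrow> (int \<Rightarrow> int) \<Rightarrow> nat" where
  "des_A n \<pi> = card {i \<in> {1..int n - 1}. \<pi> i > \<pi> (i + 1)}"

definition des_B :: "nat \<Rightarrow> (int \<Rightarrow> int) \<Rightarrow> nat" where
  "des_B n \<pi> = card {i \<in> {0..int n - 1}. \<pi> i > \<pi> (i + 1)}"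

definition fdes :: "nat \<Rightarrow> (int \<Rightarrow> int) \<Rightarrow> nat" where
  "fdes n \<pi> = des_A n \<pi> + des_B n \<pi>"

(* The ring of power series in s and t is represented as (Q[[s]])[[t]]: the coefficient of
   s^j t^k in f is fps_nth (fps_nth f k) j. *)
definition fps_s :: "rat fps fps" where
  "fps_s = fps_const fps_X"

definition fps_t :: "rat fps fps" where
  "fps_t = fps_X"

definition fps2 :: "(nat \<Rightarrow> nat \<Rightarrow> rat) \<Rightarrow> rat fps fps" where
  "fps2 a = Abs_fps (\<lambda>k. Abs_fps (\<lambda>j. a j k))"

definition F_series :: "nat \<Rightarrow> (int \<Rightarrow> int) \<Rightarrow> rat fps fps" where
  "F_series n \<pi> =
     (\<Sum>(\<sigma>, \<tau>) \<in> {(\<sigma>, \<tau>) \<in> hyperoctahedral n \<times> hyperoctahedral n. \<sigma> \<circ> \<tau> = \<pi>}.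
        fps_s ^ fdes n \<sigma> * fps_t ^ fdes n \<tau>)"

lemma finite_hyperoctahedral: "finite (hyperoctahedral n)"
  by (rule finite_subset[OF _ finite_permutations[of "{- int n..int n}"]])
     (auto simp: hyperoctahedral_def)

(* The coefficient ring Q[[s]] is not a field, so it has to be checked that the library's
   division of power series over it is genuine division when the denominator has nonzero
   constant term. *)
lemma fps2_divide_mult_cancel:
  fixes f g :: "rat fps fps"
  assumes "fps_nth (fps_nth g 0) 0 \<noteq> 0"
  shows "f / g * g = f"
proof -
  have g0: "fps_nth g 0 \<noteq> 0" using assms by auto
  have u: "inverse (fps_nth g 0) * fps_nth g 0 = 1"
    using assms by (rule inverse_mult_eq_1)
  have "inverse g = fps_right_inverse g (inverse (fps_nth g 0))"
    by (simp add: fps_inverse_def)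
  then have "g * inverse g = 1"
    using fps_right_inverse[of g "inverse (fps_nth g 0)"] u by (simp add: mult.commute)
  then show ?thesis
    using fps_divide_unit[OF g0, of f] by (simp add: mult.assoc mult.commute[of _ g])
qed

end

theory Submission
  imports Defs
begin

text \<open>An odd map \<open>f\<close> on \<open>{-n..n}\<close> is sorted by exactly one \<open>\<sigma>\<close> in the hyperoctahedral group:
  list the points by increasing value of \<open>f\<close>, ties being broken by the points themselves. Let
  \<open>\<omega>\<^sub>\<pi>(K)\<close> be the number of odd maps sorted by \<open>\<pi>\<close> with nonzero points sent to the grid
  \<open>{-K, -K + 2, ..., K}\<close>. Only the order of the values matters, and they have to increase strictly
  at the descents of \<open>\<pi>\<close>, so halving the values gives
  \<open>\<omega>\<^sub>\<pi>(K) = \<lfloor>(K - fdes \<pi>) / 2\<rfloor> + n choose n\<close>; its generating function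
  in \<open>K\<close> is \<open>x\<close> to the power \<open>fdes \<pi>\<close>, divided by \<open>(1 - x)(1 - x\<^sup>2)\<^sup>n\<close>.

  The map \<open>(g, h) \<mapsto> (j + 1) h + g\<close> identifies the lexicographically ordered product of the grids
  for \<open>k\<close> and \<open>j\<close> with the grid for \<open>(j + 1)(k + 1) - 1 = jk + j + k\<close>. If \<open>\<sigma>\<close> sorts \<open>g\<close>, breaking
  ties of \<open>h\<close> by \<open>g\<close> is the same as breaking them by \<open>\<sigma>\<^sup>-\<^sup>1\<close>, so \<open>\<pi>\<close> sorts the combined
  map if and only if \<open>\<sigma>\<^sup>-\<^sup>1\<pi>\<close> sorts \<open>h \<circ> \<sigma>\<close>. Hence \<open>\<omega>\<^sub>\<pi>(jk + j + k)\<close> is the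
  sum of \<open>\<omega>\<^sub>\<sigma>(j) \<omega>\<^sub>\<tau>(k)\<close> over all \<open>\<sigma>\<tau> = \<pi>\<close>.\<close>

section \<open>The group\<close>

text \<open>Outside the interval \<open>\<pi>\<close> is the identity, so its oddness extends to all
  integers.\<close>

lemma hyperoctahedral_odd:
  assumes "\<pi> \<in> hyperoctahedral n"
  shows "\<pi> (- x) = - \<pi> x"
  using assms by (cases "x \<in> {- int n..int n}") (auto simp: hyperoctahedral_def permutes_def)

lemma hyperoctahedral_zero:
  assumes "\<pi> \<in> hyperoctahedral n"
  shows "\<pi> 0 = 0"
  using hyperoctahedral_odd[OF assms, of 0] by simp

lemma hyperoctahedral_permutes: "\<pi> \<in> hyperoctahedral n \<Longrightarrow> \<pi> permutes {- int n..int n}"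
  by (simp add: hyperoctahedral_def)

lemma hyperoctahedral_abs_le_iff:
  assumes "\<pi> \<in> hyperoctahedral n"
  shows "\<bar>\<pi> x\<bar> \<le> int n \<longleftrightarrow> \<bar>x\<bar> \<le> int n"
  using permutes_in_image[OF hyperoctahedral_permutes[OF assms], of x] by (auto simp: abs_le_iff)

lemma hyperoctahedral_eq_iff:
  assumes "\<pi> \<in> hyperoctahedral n"
  shows "\<pi> x = \<pi> y \<longleftrightarrow> x = y"
  using permutes_inj[OF hyperoctahedral_permutes[OF assms]] by (auto simp: inj_def)

lemma hyperoctahedral_eq_0_iff:
  assumes "\<pi> \<in> hyperoctahedral n"
  shows "\<pi> x = 0 \<longleftrightarrow> x = 0"
  using hyperoctahedral_eq_iff[OF assms, of x 0] hyperoctahedral_zero[OF assms] by simp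

lemma inv_hyperoctahedral:
  assumes "\<pi> \<in> hyperoctahedral n"
  shows "inv \<pi> \<in> hyperoctahedral n"
proof -
  note p = hyperoctahedral_permutes[OF assms]
  have "inv \<pi> (- x) = - inv \<pi> x" for x
    using hyperoctahedral_odd[OF assms, of "inv \<pi> x"] permutes_inverses[OF p] by metis
  then show ?thesis using permutes_inv[OF p] by (simp add: hyperoctahedral_def)
qed

lemma comp_hyperoctahedral:
  assumes "\<sigma> \<in> hyperoctahedral n" "\<tau> \<in> hyperoctahedral n"
  shows "\<sigma> \<circ> \<tau> \<in> hyperoctahedral n"
  using assms permutes_compose[of \<tau> "{- int n..int n}" \<sigma>]
    hyperoctahedral_odd[OF assms(1)] hyperoctahedral_odd[OF assms(2)]
  by (simp add: hyperoctahedral_def)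

section \<open>Sorting odd maps\<close>

definition precedes :: "(int \<Rightarrow> int) \<Rightarrow> int \<Rightarrow> int \<Rightarrow> bool" where
  "precedes f x y \<longleftrightarrow> f x < f y \<or> f x = f y \<and> x < y"

lemma precedes_irrefl: "\<not> precedes f x x"
  by (simp add: precedes_def)

lemma precedes_trans: "precedes f x y \<Longrightarrow> precedes f y z \<Longrightarrow> precedes f x z"
  by (auto simp: precedes_def)

lemma precedes_total: "x \<noteq> y \<Longrightarrow> precedes f x y \<or> precedes f y x"
  by (auto simp: precedes_def)

definition sorts :: "nat \<Rightarrow> (int \<Rightarrow> int) \<Rightarrow> (int \<Rightarrow> int) \<Rightarrow> bool" where
  "sorts n \<pi> f \<longleftrightarrow>
     (\<forall>x\<in>{- int n..int n}. \<forall>y\<in>{- int n..int n}. x < y \<longrightarrow> precedes f (\<pi> x) (\<pi> y))"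

text \<open>\<open>sorts\<close> only passes from positions to values. As positions are linearly
  ordered and \<open>precedes\<close> is asymmetric, trichotomy yields the converse.\<close>

lemma sorts_precedes_iff:
  assumes \<sigma>: "\<sigma> \<in> hyperoctahedral n" "sorts n \<sigma> f"
    and "\<bar>x\<bar> \<le> int n" "\<bar>y\<bar> \<le> int n"
  shows "precedes f x y \<longleftrightarrow> inv \<sigma> x < inv \<sigma> y"
proof -
  note p = hyperoctahedral_permutes[OF \<sigma>(1)]
  have "\<bar>inv \<sigma> x\<bar> \<le> int n" "\<bar>inv \<sigma> y\<bar> \<le> int n"
    using hyperoctahedral_abs_le_iff[OF inv_hyperoctahedral[OF \<sigma>(1)]] assms by blast+
  then have *: "inv \<sigma> x \<in> {- int n..int n}" "inv \<sigma> y \<in> {- int n..int n}" by auto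
  show ?thesis
  proof (cases "inv \<sigma> x" "inv \<sigma> y" rule: linorder_cases)
    case less
    then show ?thesis using \<sigma>(2) * permutes_inverses[OF p] unfolding sorts_def by metis
  next
    case equal
    then have "x = y" using permutes_inverses[OF p] by metis
    then show ?thesis by (simp add: precedes_irrefl)
  next
    case greater
    then have "precedes f y x" using \<sigma>(2) * permutes_inverses[OF p] unfolding sorts_def by metis
    then show ?thesis using greater precedes_trans precedes_irrefl by (metis order_less_not_sym)
  qed
qed

text \<open>The shift by \<open>n\<close> moves the ranks from 0, ..., 2n to -n, ..., n, the
  positions on which the group acts.\<close>

definition rank :: "nat \<Rightarrow> (int \<Rightarrow> int) \<Rightarrow> int \<Rightarrow> int" where
  "rank n f x = int (card {y \<in> {- int n..int n}. precedes f y x}) - int n"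

text \<open>The points preceding \<open>x\<close> are the \<open>\<sigma>\<close>-images of the
  positions below \<open>inv \<sigma> x\<close>. Since the rank depends on \<open>f\<close> alone,
  \<open>f\<close> determines \<open>\<sigma>\<close>.\<close>

lemma rank_sorts:
  assumes \<sigma>: "\<sigma> \<in> hyperoctahedral n" "sorts n \<sigma> f" and x: "\<bar>x\<bar> \<le> int n"
  shows "rank n f x = inv \<sigma> x"
proof -
  note p = hyperoctahedral_permutes[OF \<sigma>(1)]
  have ix: "\<bar>inv \<sigma> x\<bar> \<le> int n"
    using hyperoctahedral_abs_le_iff[OF inv_hyperoctahedral[OF \<sigma>(1)]] x by blast
  have "{y \<in> {- int n..int n}. precedes f y x} = \<sigma> ` {- int n..<inv \<sigma> x}" (is "?L = ?R")
  proof
    show "?L \<subseteq> ?R"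
    proof
      fix y assume y: "y \<in> ?L"
      then have "inv \<sigma> y < inv \<sigma> x"
        using sorts_precedes_iff[OF \<sigma>, of y x] x by auto
      moreover have "\<bar>inv \<sigma> y\<bar> \<le> int n"
        using hyperoctahedral_abs_le_iff[OF inv_hyperoctahedral[OF \<sigma>(1)], of y] y by auto
      moreover have "y = \<sigma> (inv \<sigma> y)" using permutes_inverses[OF p] by simp
      ultimately show "y \<in> ?R" by (intro image_eqI[of _ _ "inv \<sigma> y"]) auto
    qed
    show "?R \<subseteq> ?L"
    proof
      fix y assume "y \<in> ?R"
      then obtain z where z: "y = \<sigma> z" "- int n \<le> z" "z < inv \<sigma> x" by auto
      then have "\<bar>\<sigma> z\<bar> \<le> int n"
        using hyperoctahedral_abs_le_iff[OF \<sigma>(1), of z] ix by auto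
      moreover have "precedes f (\<sigma> z) x"
        using sorts_precedes_iff[OF \<sigma>, of "\<sigma> z" x] x z calculation permutes_inverses[OF p] by auto
      ultimately show "y \<in> ?L" using z by auto
    qed
  qed
  moreover have "card (\<sigma> ` {- int n..<inv \<sigma> x}) = nat (inv \<sigma> x + int n)"
    using permutes_inj[OF p] by (subst card_image) (auto simp: inj_on_def inj_def)
  ultimately show ?thesis using ix by (simp add: rank_def)
qed

lemma sorts_unique:
  assumes "\<sigma> \<in> hyperoctahedral n" "sorts n \<sigma> f" "\<tau> \<in> hyperoctahedral n" "sorts n \<tau> f"
  shows "\<sigma> = \<tau>"
proof -
  have "inv \<sigma> x = inv \<tau> x" for x
  proof (cases "\<bar>x\<bar> \<le> int n")
    case True
    then show ?thesis using rank_sorts assms by metis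
  next
    case False
    then have "x \<notin> {- int n..int n}" by auto
    then show ?thesis
      using assms inv_hyperoctahedral hyperoctahedral_permutes permutes_not_in by metis
  qed
  then have "inv \<sigma> = inv \<tau>" by auto
  then show ?thesis
    using assms hyperoctahedral_permutes permutes_inv_inv by metis
qed

text \<open>The rank is the inverse of the wanted element: it is strictly increasing along
  \<open>precedes f\<close>, hence a permutation of the interval, and it is odd because negation
  reverses the order of an odd map.\<close>

lemma sorts_exists:
  assumes odd: "\<And>x. f (- x) = - f x"
  obtains \<sigma> where "\<sigma> \<in> hyperoctahedral n" "sorts n \<sigma> f"
proof -
  let ?I = "{- int n..int n}"
  define below where "below x = {y \<in> ?I. precedes f y x}" for x
  have fin: "finite (below x)" for x
    by (rule finite_subset[of _ ?I]) (auto simp: below_def)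
  have mono: "rank n f x < rank n f y" if "x \<in> ?I" "precedes f x y" for x y
  proof -
    have "below x \<subset> below y"
      using that precedes_trans precedes_irrefl unfolding below_def by blast
    then show ?thesis
      using psubset_card_mono[OF fin] by (simp add: rank_def below_def)
  qed
  have sub: "below x \<subseteq> ?I - {x}" for x
    using precedes_irrefl by (auto simp: below_def)
  have rng: "rank n f x \<in> ?I" if "x \<in> ?I" for x
  proof -
    have "card (below x) \<le> card (?I - {x})" by (intro card_mono sub) auto
    also have "\<dots> = 2 * n" using that by (subst card_Diff_singleton) auto
    finally show ?thesis by (auto simp: rank_def below_def)
  qed
  have rank_odd: "rank n f (- x) = - rank n f x" if "x \<in> ?I" for x
  proof -
    have flip: "precedes f (- a) (- x) \<longleftrightarrow> precedes f x a" for a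
      using odd by (auto simp: precedes_def)
    \<comment> \<open>The points below \<open>- x\<close> are the negatives of the points above
      \<open>x\<close>. Together with the points below \<open>x\<close> these account for the 2n
      points other than \<open>x\<close>.\<close>
    have "below (- x) = uminus ` {y \<in> ?I. precedes f x y}" (is "_ = uminus ` ?U")
    proof
      show "below (- x) \<subseteq> uminus ` ?U"
      proof
        fix y assume "y \<in> below (- x)"
        then have "- y \<in> ?U" using flip[of "- y"] by (auto simp: below_def)
        then show "y \<in> uminus ` ?U" by (intro image_eqI[of _ _ "- y"]) auto
      qed
      show "uminus ` ?U \<subseteq> below (- x)" using flip by (auto simp: below_def)
    qed
    then have "card (below (- x)) = card ?U" by (simp add: card_image)
    moreover have "below x \<union> ?U = ?I - {x}"
      using precedes_total[of _ x f] precedes_irrefl by (auto simp: below_def)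
    moreover have "below x \<inter> ?U = {}"
      using precedes_trans precedes_irrefl unfolding below_def by blast
    moreover have "card (?I - {x}) = 2 * n" using that by (subst card_Diff_singleton) auto
    moreover have "finite ?U" by (rule finite_subset[of _ ?I]) auto
    ultimately have "card (below (- x)) + card (below x) = 2 * n"
      using card_Un_disjoint[of "below x" ?U] fin by simp
    then show ?thesis by (simp add: rank_def below_def)
  qed
  define \<rho> where "\<rho> x = (if x \<in> ?I then rank n f x else x)" for x
  have rank_eq: "rank n f x = \<rho> x" if "x \<in> ?I" for x using that by (simp only: \<rho>_def if_True)
  have inj: "inj_on \<rho> ?I"
  proof (rule inj_onI)
    fix x y assume "x \<in> ?I" "y \<in> ?I" "\<rho> x = \<rho> y"
    then show "x = y"
      using mono[of x y] mono[of y x] precedes_total[of x y f] by (auto simp: \<rho>_def)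
  qed
  moreover have "\<rho> ` ?I \<subseteq> ?I" using rng rank_eq by (metis image_subsetI)
  ultimately have "\<rho> ` ?I = ?I" by (intro endo_inj_surj) auto
  with inj have "bij_betw \<rho> ?I ?I" by (simp add: bij_betw_def)
  then have perm: "\<rho> permutes ?I" by (rule bij_imp_permutes) (simp only: \<rho>_def if_False)
  then have \<rho>: "\<rho> \<in> hyperoctahedral n"
    using rank_odd by (auto simp: hyperoctahedral_def \<rho>_def)
  have "sorts n (inv \<rho>) f"
    unfolding sorts_def
  proof (intro ballI impI)
    fix x y assume xy: "x \<in> ?I" "y \<in> ?I" "x < y"
    have I: "inv \<rho> x \<in> ?I" "inv \<rho> y \<in> ?I"
      using permutes_in_image[OF permutes_inv[OF perm]] xy by blast+
    have r: "rank n f (inv \<rho> x) = x" "rank n f (inv \<rho> y) = y"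
      by (simp_all only: rank_eq[OF I(1)] rank_eq[OF I(2)] permutes_inverses(1)[OF perm])
    then have "inv \<rho> x \<noteq> inv \<rho> y" using xy by auto
    then show "precedes f (inv \<rho> x) (inv \<rho> y)"
      using precedes_total mono[OF I(2), of "inv \<rho> x"] xy(3) unfolding r by (meson less_asym)
  qed
  then show ?thesis using that inv_hyperoctahedral[OF \<rho>] by blast
qed

section \<open>Odd maps into a symmetric grid\<close>

definition grid :: "nat \<Rightarrow> int set" where
  "grid K = {v. \<bar>v\<bar> \<le> int K \<and> even (v - int K)}"

text \<open>The value at 0 is 0 even when K is odd and 0 is not a grid point.\<close>

definition odd_maps :: "nat \<Rightarrow> nat \<Rightarrow> (int \<Rightarrow> int) set" where
  "odd_maps n K = {f. (\<forall>x. f (- x) = - f x) \<and> (\<forall>x. \<bar>x\<bar> > int n \<longrightarrow> f x = 0) \<and>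
     (\<forall>x. x \<noteq> 0 \<longrightarrow> \<bar>x\<bar> \<le> int n \<longrightarrow> f x \<in> grid K)}"

definition sorted_maps :: "nat \<Rightarrow> (int \<Rightarrow> int) \<Rightarrow> nat \<Rightarrow> (int \<Rightarrow> int) set" where
  "sorted_maps n \<pi> K = {f \<in> odd_maps n K. sorts n \<pi> f}"

lemma odd_maps_uminus: "f \<in> odd_maps n K \<Longrightarrow> f (- x) = - f x"
  by (simp add: odd_maps_def)

lemma odd_maps_zero: "f \<in> odd_maps n K \<Longrightarrow> f 0 = 0"
  using odd_maps_uminus[of f n K 0] by simp

lemma odd_maps_outside: "f \<in> odd_maps n K \<Longrightarrow> \<bar>x\<bar> > int n \<Longrightarrow> f x = 0"
  by (simp add: odd_maps_def)

lemma odd_maps_grid: "f \<in> odd_maps n K \<Longrightarrow> x \<noteq> 0 \<Longrightarrow> \<bar>x\<bar> \<le> int n \<Longrightarrow> f x \<in> grid K"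
  by (simp add: odd_maps_def)

lemma odd_maps_comp:
  assumes "f \<in> odd_maps n K" "\<sigma> \<in> hyperoctahedral n"
  shows "f \<circ> \<sigma> \<in> odd_maps n K"
  using assms hyperoctahedral_odd[OF assms(2)] hyperoctahedral_abs_le_iff[OF assms(2)]
    hyperoctahedral_eq_0_iff[OF assms(2)]
  by (auto simp: odd_maps_def not_le[symmetric])

section \<open>Grid points as two-digit numbers\<close>

lemma grid_uminus: "v \<in> grid K \<Longrightarrow> - v \<in> grid K"
  by (auto simp: grid_def)

lemma grid_combine:
  assumes "g \<in> grid j" "h \<in> grid k"
  shows "(int j + 1) * h + g \<in> grid ((j + 1) * (k + 1) - 1)"
proof -
  have "\<bar>(int j + 1) * h + g\<bar> \<le> (int j + 1) * \<bar>h\<bar> + \<bar>g\<bar>"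
    by (metis abs_mult abs_of_nat abs_triangle_ineq of_nat_Suc add.commute)
  also have "\<dots> \<le> (int j + 1) * int k + int j"
    using assms by (intro add_mono mult_left_mono) (auto simp: grid_def)
  finally have 1: "\<bar>(int j + 1) * h + g\<bar> \<le> int ((j + 1) * (k + 1) - 1)"
    by (simp add: algebra_simps)
  have "(int j + 1) * h + g - int ((j + 1) * (k + 1) - 1)
      = (int j + 1) * (h - int k) + (g - int j)"
    by (simp add: algebra_simps)
  then have "even ((int j + 1) * h + g - int ((j + 1) * (k + 1) - 1))"
    using assms by (auto simp: grid_def)
  with 1 show ?thesis by (simp add: grid_def)
qed

text \<open>Points of one grid have equal parity, so \<open>h' - h\<close> is at least 2 and
  contributes at least 2(j + 1), whereas \<open>g\<close> and \<open>g'\<close> differ by at most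
  2j.\<close>

lemma grid_combine_less:
  assumes "g \<in> grid j" "h \<in> grid k" "g' \<in> grid j" "h' \<in> grid k" "h < h'"
  shows "(int j + 1) * h + g < (int j + 1) * h' + g'"
proof -
  have "even (h - int k)" "even (h' - int k)" using assms by (simp_all add: grid_def)
  then have "even (h' - h)" by presburger
  then have "2 \<le> h' - h" using assms(5) by presburger
  then have "(int j + 1) * 2 \<le> (int j + 1) * (h' - h)" by (intro mult_left_mono) auto
  moreover have "\<bar>g\<bar> \<le> int j" "\<bar>g'\<bar> \<le> int j" using assms(1,3) by (simp_all add: grid_def)
  ultimately show ?thesis by (simp add: right_diff_distrib abs_le_iff)
qed

lemma grid_split:
  assumes "f \<in> grid ((j + 1) * (k + 1) - 1)"
  obtains g h where "g \<in> grid j" "h \<in> grid k" "f = (int j + 1) * h + g"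
proof -
  define K where "K = (int j + 1) * (int k + 1) - 1"
  have K: "int ((j + 1) * (k + 1) - 1) = K" by (simp add: K_def algebra_simps)
  have f: "\<bar>f\<bar> \<le> K" "even (f - K)" using assms unfolding grid_def K by simp_all
  then have "even (f + K)" by presburger
  then obtain q where q: "f + K = 2 * q" by (elim evenE)
  \<comment> \<open>Under v -> (v + K) / 2 the grid becomes 0, ..., K, and the splitting becomes
    division with remainder by j + 1.\<close>
  define a b where "a = q div (int j + 1)" and "b = q mod (int j + 1)"
  have ab: "q = (int j + 1) * a + b" by (simp add: a_def b_def)
  have q0: "0 \<le> q" "q < (int j + 1) * (int k + 1)" using f q by (auto simp: K_def)
  have b: "0 \<le> b" "b \<le> int j" using pos_mod_bound[of "int j + 1" q] by (auto simp: b_def)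
  have a: "0 \<le> a" using q0 by (auto simp: a_def pos_imp_zdiv_nonneg_iff)
  have "(int j + 1) * a < (int j + 1) * (int k + 1)" using ab q0 b by linarith
  then have "a \<le> int k" by (subst (asm) mult_less_cancel_left_pos) auto
  then have "2 * b - int j \<in> grid j" "2 * a - int k \<in> grid k"
    using a b by (auto simp: grid_def)
  moreover have "f = (int j + 1) * (2 * a - int k) + (2 * b - int j)"
    using q unfolding ab K_def by (simp add: algebra_simps)
  ultimately show ?thesis using that by blast
qed

section \<open>Lexicographic combination of two odd maps\<close>

definition combine :: "nat \<Rightarrow> (int \<Rightarrow> int) \<Rightarrow> (int \<Rightarrow> int) \<Rightarrow> int \<Rightarrow> int" where
  "combine j g h x = (int j + 1) * h x + g x"

lemma combine_in_odd_maps: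
  assumes "g \<in> odd_maps n j" "h \<in> odd_maps n k"
  shows "combine j g h \<in> odd_maps n ((j + 1) * (k + 1) - 1)"
proof -
  have "combine j g h (- x) = - combine j g h x" for x
    using assms by (simp add: combine_def odd_maps_uminus)
  moreover have "combine j g h x = 0" if "\<bar>x\<bar> > int n" for x
    using assms that by (simp add: combine_def odd_maps_outside)
  moreover have "combine j g h x \<in> grid ((j + 1) * (k + 1) - 1)" if "x \<noteq> 0" "\<bar>x\<bar> \<le> int n" for x
    unfolding combine_def using assms that by (intro grid_combine) (auto intro: odd_maps_grid)
  ultimately show ?thesis by (simp add: odd_maps_def)
qed

text \<open>The point 0 needs its own argument, since its value 0 may lie off the grid. There
  \<open>h\<close> may jump by only 1, but only one of the two \<open>g\<close>-values can be
  nonzero, and it is smaller than j + 1 in absolute value.\<close>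

lemma combine_less:
  assumes g: "g \<in> odd_maps n j" and h: "h \<in> odd_maps n k"
    and x: "\<bar>x\<bar> \<le> int n" and y: "\<bar>y\<bar> \<le> int n" and less: "h x < h y"
  shows "combine j g h x < combine j g h y"
proof -
  have bound: "\<bar>g z\<bar> \<le> int j" if "\<bar>z\<bar> \<le> int n" for z
    using odd_maps_grid[OF g _ that] odd_maps_zero[OF g] by (cases "z = 0") (auto simp: grid_def)
  consider "x = 0" | "y = 0" | "x \<noteq> 0" "y \<noteq> 0" by blast
  then show ?thesis
  proof cases
    case 1
    then have "int j + 1 \<le> (int j + 1) * h y"
      using less odd_maps_zero[OF h] 1 mult_left_mono[of 1 "h y" "int j + 1"] by simp
    then show ?thesis
      using 1 bound[OF y] odd_maps_zero[OF g] odd_maps_zero[OF h]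
      unfolding combine_def by (simp only: mult_zero_right add_0)
  next
    case 2
    then have "(int j + 1) * h x \<le> - (int j + 1)"
      using less odd_maps_zero[OF h] 2 mult_left_mono[of "h x" "- 1" "int j + 1"] by simp
    then show ?thesis
      using 2 bound[OF x] odd_maps_zero[OF g] odd_maps_zero[OF h]
      unfolding combine_def by (simp only: mult_zero_right add_0)
  next
    case 3
    then show ?thesis
      unfolding combine_def using g h x y less
      by (intro grid_combine_less[where k = k]) (auto intro: odd_maps_grid)
  qed
qed

lemma precedes_combine_iff:
  assumes "g \<in> odd_maps n j" "h \<in> odd_maps n k" "\<bar>x\<bar> \<le> int n" "\<bar>y\<bar> \<le> int n"
  shows "precedes (combine j g h) x y \<longleftrightarrow> h x < h y \<or> h x = h y \<and> precedes g x y"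
proof (cases "h x" "h y" rule: linorder_cases)
  case less
  then show ?thesis using combine_less[of g n j h k x y] assms by (auto simp: precedes_def)
next
  case equal
  then show ?thesis by (auto simp: precedes_def combine_def)
next
  case greater
  then show ?thesis using combine_less[of g n j h k y x] assms by (auto simp: precedes_def)
qed

text \<open>By \<open>grid_combine_less\<close> neither of \<open>h x\<close> and
  \<open>h' x\<close> can exceed the other; \<open>g\<close> is then recovered by
  subtraction.\<close>

lemma combine_eqD:
  assumes "g \<in> odd_maps n j" "h \<in> odd_maps n k" "g' \<in> odd_maps n j" "h' \<in> odd_maps n k"
    and eq: "combine j g h = combine j g' h'"
  shows "g = g' \<and> h = h'"
proof -
  have "h x = h' x" for x
  proof (cases "x = 0 \<or> \<bar>x\<bar> > int n")
    case True
    then show ?thesis using assms odd_maps_zero odd_maps_outside by metis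
  next
    case False
    then have *: "x \<noteq> 0" "\<bar>x\<bar> \<le> int n" by auto
    have "(int j + 1) * h x + g x = (int j + 1) * h' x + g' x"
      using fun_cong[OF eq, of x] by (simp add: combine_def)
    then show ?thesis
      using grid_combine_less[of "g x" j "h x" k "g' x" "h' x"]
        grid_combine_less[of "g' x" j "h' x" k "g x" "h x"] odd_maps_grid[OF _ *] assms
      by (metis less_irrefl linorder_less_linear)
  qed
  then have "h = h'" by auto
  moreover from this have "g x = g' x" for x
    using fun_cong[OF eq, of x] by (simp add: combine_def)
  ultimately show ?thesis by auto
qed

lemma combine_surj:
  assumes f: "f \<in> odd_maps n ((j + 1) * (k + 1) - 1)"
  obtains g h where "g \<in> odd_maps n j" "h \<in> odd_maps n k" "f = combine j g h"
proof -
  have "\<exists>g h. g \<in> grid j \<and> h \<in> grid k \<and> f x = (int j + 1) * h + g"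
    if "0 < x" "x \<le> int n" for x
    using grid_split[OF odd_maps_grid[OF f, of x]] that by (metis abs_of_pos less_irrefl)
  then obtain G H where GH: "\<And>x. 0 < x \<Longrightarrow> x \<le> int n \<Longrightarrow>
      G x \<in> grid j \<and> H x \<in> grid k \<and> f x = (int j + 1) * H x + G x" by metis
  \<comment> \<open>The digits are chosen at positive points and extended by sign, so that oddness
    and the value 0 at 0 hold by construction.\<close>
  define ext where
    "ext u x = (if x = 0 \<or> \<bar>x\<bar> > int n then 0 else sgn x * u \<bar>x\<bar>)" for u :: "int \<Rightarrow> int" and x
  have "ext G \<in> odd_maps n j" "ext H \<in> odd_maps n k"
    using GH grid_uminus by (auto simp: odd_maps_def ext_def sgn_if)
  moreover have "f x = combine j (ext G) (ext H) x" for x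
  proof (cases "x = 0 \<or> \<bar>x\<bar> > int n")
    case True
    then show ?thesis
      using odd_maps_zero[OF f] odd_maps_outside[OF f] by (auto simp: combine_def ext_def)
  next
    case False
    then consider "0 < x" "x \<le> int n" | "0 < - x" "- x \<le> int n" by linarith
    then show ?thesis
    proof cases
      case 1
      then show ?thesis using GH[OF 1] by (simp add: combine_def ext_def)
    next
      case 2
      then have "f x = - ((int j + 1) * H (- x) + G (- x))"
        using GH[OF 2] odd_maps_uminus[OF f, of x] by simp
      then show ?thesis using 2 by (simp add: combine_def ext_def)
    qed
  qed
  ultimately show ?thesis using that[of "ext G" "ext H"] by auto
qed

lemma sorts_combine_iff:
  assumes g: "g \<in> odd_maps n j" and h: "h \<in> odd_maps n k"
    and \<pi>: "\<pi> \<in> hyperoctahedral n" and \<sigma>: "\<sigma> \<in> hyperoctahedral n" "sorts n \<sigma> g"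
  shows "sorts n \<pi> (combine j g h) \<longleftrightarrow> sorts n (inv \<sigma> \<circ> \<pi>) (h \<circ> \<sigma>)"
proof -
  have "precedes (combine j g h) (\<pi> x) (\<pi> y)
      \<longleftrightarrow> precedes (h \<circ> \<sigma>) ((inv \<sigma> \<circ> \<pi>) x) ((inv \<sigma> \<circ> \<pi>) y)"
    if "x \<in> {- int n..int n}" "y \<in> {- int n..int n}" for x y
  proof -
    have "\<bar>\<pi> x\<bar> \<le> int n" "\<bar>\<pi> y\<bar> \<le> int n"
      unfolding hyperoctahedral_abs_le_iff[OF \<pi>] using that by auto
    \<comment> \<open>Among ties of \<open>h\<close>, \<open>precedes g\<close> compares the
      positions under \<open>inv \<sigma>\<close>, which is how
      \<open>precedes (h \<circ> \<sigma>)\<close> breaks ties between these positions.\<close>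
    then show ?thesis
      using precedes_combine_iff[OF g h] sorts_precedes_iff[OF \<sigma>]
        permutes_inverses(1)[OF hyperoctahedral_permutes[OF \<sigma>(1)]]
      by (simp add: precedes_def[of "h \<circ> \<sigma>"])
  qed
  then show ?thesis unfolding sorts_def by blast
qed

section \<open>Factorizations of a group element and the product bijection\<close>

definition factorizations ::
    "nat \<Rightarrow> (int \<Rightarrow> int) \<Rightarrow> ((int \<Rightarrow> int) \<times> (int \<Rightarrow> int)) set" where
  "factorizations n \<pi> = {(\<sigma>, \<tau>) \<in> hyperoctahedral n \<times> hyperoctahedral n. \<sigma> \<circ> \<tau> = \<pi>}"

text \<open>The inverse splits a map into \<open>g\<close> and \<open>h\<close>, takes the
  \<open>\<sigma>\<close> that sorts \<open>g\<close>, and returns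
  \<open>inv \<sigma> \<circ> \<pi>\<close> as second factor with \<open>h \<circ> \<sigma>\<close>
  as the map it sorts.\<close>

lemma bij_betw_sorted_maps:
  assumes \<pi>: "\<pi> \<in> hyperoctahedral n"
  shows "bij_betw (\<lambda>((\<sigma>, \<tau>), g, h). combine j g (h \<circ> inv \<sigma>))
    (SIGMA (\<sigma>, \<tau>):factorizations n \<pi>. sorted_maps n \<sigma> j \<times> sorted_maps n \<tau> k)
    (sorted_maps n \<pi> ((j + 1) * (k + 1) - 1))"
    (is "bij_betw ?\<Phi> ?A ?B")
proof -
  have maps: "combine j g (h \<circ> inv \<sigma>) \<in> ?B"
    if "(\<sigma>, \<tau>) \<in> factorizations n \<pi>" "g \<in> sorted_maps n \<sigma> j" "h \<in> sorted_maps n \<tau> k"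
    for \<sigma> \<tau> g h
  proof -
    have \<sigma>: "\<sigma> \<in> hyperoctahedral n" and eq: "\<pi> = \<sigma> \<circ> \<tau>"
      using that by (auto simp: factorizations_def)
    have g: "g \<in> odd_maps n j" "sorts n \<sigma> g" and h: "h \<in> odd_maps n k" "sorts n \<tau> h"
      using that by (auto simp: sorted_maps_def)
    note p = hyperoctahedral_permutes[OF \<sigma>]
    have h': "h \<circ> inv \<sigma> \<in> odd_maps n k"
      using odd_maps_comp[OF h(1) inv_hyperoctahedral[OF \<sigma>]] .
    have 1: "inv \<sigma> \<circ> \<pi> = \<tau>" using permutes_inverses[OF p] by (auto simp: eq)
    have 2: "h \<circ> inv \<sigma> \<circ> \<sigma> = h" using permutes_inverses[OF p] by auto
    have "sorts n (inv \<sigma> \<circ> \<pi>) (h \<circ> inv \<sigma> \<circ> \<sigma>)" unfolding 1 2 by (rule h(2))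
    then have "sorts n \<pi> (combine j g (h \<circ> inv \<sigma>))"
      using sorts_combine_iff[OF g(1) h' \<pi> \<sigma> g(2)] by simp
    with combine_in_odd_maps[OF g(1) h'] show ?thesis by (simp add: sorted_maps_def)
  qed
  show ?thesis
  proof (rule bij_betw_imageI)
    show "inj_on ?\<Phi> ?A"
    proof (rule inj_onI, clarsimp)
      fix \<sigma> \<tau> g h \<sigma>' \<tau>' g' h'
      assume 1: "(\<sigma>, \<tau>) \<in> factorizations n \<pi>" "(\<sigma>', \<tau>') \<in> factorizations n \<pi>"
        and 2: "g \<in> sorted_maps n \<sigma> j" "h \<in> sorted_maps n \<tau> k"
          "g' \<in> sorted_maps n \<sigma>' j" "h' \<in> sorted_maps n \<tau>' k"
        and eq: "combine j g (h \<circ> inv \<sigma>) = combine j g' (h' \<circ> inv \<sigma>')"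
      have \<sigma>: "\<sigma> \<in> hyperoctahedral n" "\<sigma>' \<in> hyperoctahedral n" "\<sigma> \<circ> \<tau> = \<sigma>' \<circ> \<tau>'"
        using 1 by (auto simp: factorizations_def)
      have "g = g' \<and> h \<circ> inv \<sigma> = h' \<circ> inv \<sigma>'"
        using 2 by (intro combine_eqD[OF _ _ _ _ eq])
          (auto simp: sorted_maps_def intro: odd_maps_comp inv_hyperoctahedral \<sigma>)
      then have g: "g = g'" and h: "h \<circ> inv \<sigma> = h' \<circ> inv \<sigma>'" by auto
      \<comment> \<open>The shared \<open>g\<close> has only one sorting element; cancelling it
        gives equality of the second factors and of the second maps.\<close>
      then have s: "\<sigma> = \<sigma>'"
        using 2 \<sigma> sorts_unique by (auto simp: sorted_maps_def)
      have "\<tau> x = \<tau>' x" for x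
        using fun_cong[OF \<sigma>(3), of x] hyperoctahedral_eq_iff[OF \<sigma>(2)] by (simp add: s)
      moreover have "h x = h' x" for x
        using fun_cong[OF h, of "\<sigma> x"] permutes_inverses[OF hyperoctahedral_permutes[OF \<sigma>(2)]]
        by (simp add: s)
      ultimately show "\<sigma> = \<sigma>' \<and> \<tau> = \<tau>' \<and> g = g' \<and> h = h'" using s g by auto
    qed
    show "?\<Phi> ` ?A = ?B"
    proof
      show "?\<Phi> ` ?A \<subseteq> ?B" using maps by auto
      show "?B \<subseteq> ?\<Phi> ` ?A"
      proof
        fix f assume "f \<in> ?B"
        then have f: "f \<in> odd_maps n ((j + 1) * (k + 1) - 1)" "sorts n \<pi> f"
          by (auto simp: sorted_maps_def)
        obtain g h where gh: "g \<in> odd_maps n j" "h \<in> odd_maps n k" "f = combine j g h"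
          using combine_surj[OF f(1)] by blast
        obtain \<sigma> where \<sigma>: "\<sigma> \<in> hyperoctahedral n" "sorts n \<sigma> g"
          using sorts_exists[of g n] odd_maps_uminus[OF gh(1)] by blast
        note p = hyperoctahedral_permutes[OF \<sigma>(1)]
        have "sorts n (inv \<sigma> \<circ> \<pi>) (h \<circ> \<sigma>)"
          using sorts_combine_iff[OF gh(1,2) \<pi> \<sigma>] f(2) gh(3) by simp
        moreover have "(\<sigma>, inv \<sigma> \<circ> \<pi>) \<in> factorizations n \<pi>"
          using \<sigma>(1) comp_hyperoctahedral[OF inv_hyperoctahedral[OF \<sigma>(1)] \<pi>]
            permutes_inverses[OF p] by (auto simp: factorizations_def)
        ultimately have "((\<sigma>, inv \<sigma> \<circ> \<pi>), g, h \<circ> \<sigma>) \<in> ?A"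
          using gh \<sigma> odd_maps_comp[OF gh(2) \<sigma>(1)] by (auto simp: sorted_maps_def)
        moreover have "f = ?\<Phi> ((\<sigma>, inv \<sigma> \<circ> \<pi>), g, h \<circ> \<sigma>)"
        proof -
          have "h \<circ> \<sigma> \<circ> inv \<sigma> = h" using permutes_inverses[OF p] by auto
          then show ?thesis by (simp add: gh(3))
        qed
        ultimately show "f \<in> ?\<Phi> ` ?A" by blast
      qed
    qed
  qed
qed


section \<open>Counting the maps sorted by a given element\<close>

text \<open>Transitivity reduces nonnegative positions to consecutive ones, oddness reflects the
  result to nonpositive positions, and pairs of opposite sign are compared through 0.\<close>

lemma sorts_iff_steps:
  assumes f: "f \<in> odd_maps n K" and \<pi>: "\<pi> \<in> hyperoctahedral n"
  shows "sorts n \<pi> f \<longleftrightarrow> (\<forall>i<n. precedes f (\<pi> (int i)) (\<pi> (int (Suc i))))"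
proof
  assume "sorts n \<pi> f"
  then show "\<forall>i<n. precedes f (\<pi> (int i)) (\<pi> (int (Suc i)))"
    by (auto simp: sorts_def)
next
  assume step: "\<forall>i<n. precedes f (\<pi> (int i)) (\<pi> (int (Suc i)))"
  have chain: "precedes f (\<pi> (int i)) (\<pi> (int (Suc i + k)))" if "i + k < n" for i k
    using that
  proof (induction k)
    case 0
    then show ?case using step by auto
  next
    case (Suc k)
    then have "precedes f (\<pi> (int i)) (\<pi> (int (Suc i + k)))" by simp
    moreover have "precedes f (\<pi> (int (Suc i + k))) (\<pi> (int (Suc (Suc i + k))))"
      using step[rule_format, of "Suc i + k"] Suc.prems by simp
    ultimately show ?case
      using precedes_trans[of f "\<pi> (int i)" "\<pi> (int (Suc i + k))"]
      by (simp only: add_Suc_right add_Suc)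
  qed
  have nonneg: "precedes f (\<pi> x) (\<pi> y)" if "0 \<le> x" "x < y" "y \<le> int n" for x y
    using chain[of "nat x" "nat (y - x) - 1"] that by (simp add: nat_diff_distrib)
  have flip: "precedes f (\<pi> x) (\<pi> y) \<longleftrightarrow> precedes f (\<pi> (- y)) (\<pi> (- x))" for x y
    using hyperoctahedral_odd[OF \<pi>] odd_maps_uminus[OF f] by (auto simp: precedes_def)
  have nonpos: "precedes f (\<pi> x) (\<pi> y)" if "- int n \<le> x" "x < y" "y \<le> 0" for x y
    unfolding flip[of x y] using that by (intro nonneg) auto
  show "sorts n \<pi> f"
    unfolding sorts_def
  proof (intro ballI impI)
    fix x y assume "x \<in> {- int n..int n}" "y \<in> {- int n..int n}" "x < y"
    then consider "0 \<le> x" "x < y" "y \<le> int n" | "- int n \<le> x" "x < y" "y \<le> 0"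
      | "- int n \<le> x" "x < 0" "0 < y" "y \<le> int n" by fastforce
    then show "precedes f (\<pi> x) (\<pi> y)"
    proof cases
      case 3
      then show ?thesis using precedes_trans[OF nonpos[of x 0] nonneg[of 0 y]] by simp
    qed (auto intro: nonneg nonpos)
  qed
qed

section \<open>Counting integer chains with prescribed minimal gaps\<close>

definition chains :: "nat \<Rightarrow> (nat \<Rightarrow> nat) \<Rightarrow> int \<Rightarrow> (nat \<Rightarrow> int) set" where
  "chains n d m = {a. a 0 = 0 \<and> (\<forall>i>n. a i = 0) \<and>
     (\<forall>i<n. a i + int (d i) \<le> a (Suc i)) \<and> a n \<le> m}"

lemma chains_sum_le:
  assumes "a \<in> chains n d m" "i \<le> n"
  shows "int (\<Sum>k<i. d k) \<le> a i"
  using assms(2)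
proof (induction i)
  case 0
  then show ?case using assms(1) by (simp add: chains_def)
next
  case (Suc i)
  then have "a i + int (d i) \<le> a (Suc i)" using assms(1) by (simp add: chains_def)
  with Suc show ?case by simp
qed

lemma chains_le:
  assumes "a \<in> chains n d m" "i \<le> n"
  shows "a i \<le> m"
proof -
  have "a (n - k) \<le> m" for k
  proof (induction k)
    case 0
    then show ?case using assms(1) by (simp add: chains_def)
  next
    case (Suc k)
    show ?case
    proof (cases "k < n")
      case True
      then have "a (n - Suc k) + int (d (n - Suc k)) \<le> a (Suc (n - Suc k))"
        using assms(1) unfolding chains_def by simp
      moreover have "Suc (n - Suc k) = n - k" using True by simp
      ultimately show ?thesis using Suc by simp
    next
      case False
      then show ?thesis using Suc by simp
    qed
  qed
  from this[of "n - i"] show ?thesis using assms(2) by simp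
qed

lemma chains_empty: "m < int (\<Sum>k<n. d k) \<Longrightarrow> chains n d m = {}"
  using chains_sum_le[of _ n d m n] chains_le[of _ n d m n] by fastforce

text \<open>The cases are whether or not the last entry attains the bound \<open>m\<close>. If it
  does, deleting it leaves a chain whose last entry must stay \<open>d n\<close> below
  \<open>m\<close>.\<close>

lemma chains_Suc:
  "chains (Suc n) d m = chains (Suc n) d (m - 1) \<union> (\<lambda>a. a(Suc n := m)) ` chains n d (m - int (d n))"
  (is "?L = ?R1 \<union> ?R2")
proof (intro Set.set_eqI iffI)
  fix a assume a: "a \<in> ?L"
  show "a \<in> ?R1 \<union> ?R2"
  proof (cases "a (Suc n) = m")
    case True
    then have "a(Suc n := 0) \<in> chains n d (m - int (d n))"
      using a by (auto simp: chains_def dest!: spec[of _ n])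
    moreover have "a = (a(Suc n := 0))(Suc n := m)" using True by auto
    ultimately show ?thesis by blast
  next
    case False
    then show ?thesis using a by (auto simp: chains_def)
  qed
next
  fix a assume "a \<in> ?R1 \<union> ?R2"
  then show "a \<in> ?L"
    by (auto simp: chains_def less_Suc_eq)
qed

text \<open>Removing the forced gaps would leave weakly increasing sequences of length n in 0, ...,
  t. The two disjoint parts in \<open>chains_Suc\<close> realize Pascal's rule.\<close>

lemma card_chains:
  "finite (chains n d (int (\<Sum>k<n. d k) + int t)) \<and>
   card (chains n d (int (\<Sum>k<n. d k) + int t)) = (t + n choose n)"
proof (induction n arbitrary: t)
  case 0
  have "chains 0 d (int t) = {\<lambda>_. 0}"
    by (auto simp: chains_def fun_eq_iff) (metis not_gr_zero)
  then show ?case by simp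
next
  case (Suc n)
  let ?D = "int (\<Sum>k<Suc n. d k)"
  let ?N = "\<lambda>t. (\<lambda>a. a(Suc n := ?D + int t)) ` chains n d (int (\<Sum>k<n. d k) + int t)"
  have N: "finite (?N t) \<and> card (?N t) = (t + n choose n)" for t
  proof -
    have "inj_on (\<lambda>a. a(Suc n := ?D + int t)) (chains n d (int (\<Sum>k<n. d k) + int t))"
    proof (rule inj_onI)
      fix a b assume ab: "a \<in> chains n d (int (\<Sum>k<n. d k) + int t)"
          "b \<in> chains n d (int (\<Sum>k<n. d k) + int t)"
        and eq: "a(Suc n := ?D + int t) = b(Suc n := ?D + int t)"
      \<comment> \<open>At \<open>Suc n\<close> both chains have the default value 0, so overwriting
        that entry loses nothing.\<close>
      have "a i = b i" for i
        using fun_cong[OF eq, of i] ab by (cases "i = Suc n") (auto simp: chains_def)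
      then show "a = b" by auto
    qed
    then show ?thesis using Suc.IH[of t] by (simp add: card_image)
  qed
  have split: "chains (Suc n) d (?D + int t) = chains (Suc n) d (?D + int t - 1) \<union> ?N t" for t
    by (subst chains_Suc) simp
  have disj: "chains (Suc n) d (?D + int t - 1) \<inter> ?N t = {}" for t
    by (auto simp: chains_def)
  show ?case
  proof (induction t)
    case 0
    \<comment> \<open>For t = 0 the smaller bound lies below the total of the gaps, so only the
      chains attaining the bound remain.\<close>
    have "chains (Suc n) d (?D + int 0 - 1) = {}" by (rule chains_empty) simp
    then show ?case using N[of 0] by (subst (1 2) split) simp
  next
    case (Suc t)
    have "?D + int (Suc t) - 1 = ?D + int t" by simp
    then have eq: "chains (Suc n) d (?D + int (Suc t)) = chains (Suc n) d (?D + int t) \<union> ?N (Suc t)"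
      and dis: "chains (Suc n) d (?D + int t) \<inter> ?N (Suc t) = {}"
      using split[of "Suc t"] disj[of "Suc t"] by (simp_all only:)
    have "Suc t + Suc n choose Suc n = (t + Suc n choose Suc n) + (Suc t + n choose n)" by simp
    then show ?case
      unfolding eq using N[of "Suc t"] Suc card_Un_disjoint[OF _ _ dis] by (simp only: finite_Un)
  qed
qed

text \<open>Halving the values of a map that is sorted by \<open>\<pi>\<close> turns the strict inequalities at the
  descents of \<open>\<pi>\<close> into gaps of size one; the descent at position 0 imposes no condition
  if the grid consists of odd numbers.\<close>

definition gap :: "(int \<Rightarrow> int) \<Rightarrow> nat \<Rightarrow> nat \<Rightarrow> nat" where
  "gap \<pi> K i = of_bool (\<pi> (int i) > \<pi> (int (Suc i)) \<and> (0 < i \<or> even K))"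

text \<open>Integers of equal parity compare as their halves do. At position 0 the left value is 0;
  if \<open>K\<close> is odd the right value is odd, so no tie occurs and being positive means
  having a nonnegative half.\<close>

lemma precedes_iff_gap:
  assumes f: "f \<in> odd_maps n K" and \<pi>: "\<pi> \<in> hyperoctahedral n" and i: "i < n"
  shows "precedes f (\<pi> (int i)) (\<pi> (int (Suc i))) \<longleftrightarrow>
    f (\<pi> (int i)) div 2 + int (gap \<pi> K i) \<le> f (\<pi> (int (Suc i))) div 2"
proof -
  have ne: "\<pi> (int i) \<noteq> \<pi> (int (Suc i))" using hyperoctahedral_eq_iff[OF \<pi>] by simp
  have par: "even (f (\<pi> (int l)) - int K)" if "0 < l" "l \<le> n" for l
  proof -
    have "f (\<pi> (int l)) \<in> grid K"
      using that hyperoctahedral_abs_le_iff[OF \<pi>] hyperoctahedral_eq_0_iff[OF \<pi>]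
      by (intro odd_maps_grid[OF f]) auto
    then show ?thesis by (simp add: grid_def)
  qed
  have v: "even (f (\<pi> (int (Suc i))) - int K)" using par[of "Suc i"] i by simp
  show ?thesis
  proof (cases "i = 0")
    case True
    then have u: "\<pi> (int i) = 0" "f (\<pi> (int i)) = 0"
      using hyperoctahedral_zero[OF \<pi>] odd_maps_zero[OF f] by auto
    show ?thesis
      using u ne v True unfolding precedes_def gap_def by (cases "even K"; simp; presburger)
  next
    case False
    then have "even (f (\<pi> (int i)) - int K)" using par[of i] i by simp
    with v have "even (f (\<pi> (int (Suc i))) - f (\<pi> (int i)))" by presburger
    then have "f (\<pi> (int i)) < f (\<pi> (int (Suc i)))
          \<longleftrightarrow> f (\<pi> (int i)) div 2 < f (\<pi> (int (Suc i))) div 2"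
        "f (\<pi> (int i)) = f (\<pi> (int (Suc i)))
          \<longleftrightarrow> f (\<pi> (int i)) div 2 = f (\<pi> (int (Suc i))) div 2"
      by presburger+
    then show ?thesis
      using ne False unfolding precedes_def gap_def by (auto simp del: of_nat_Suc)
  qed
qed

text \<open>By oddness a sorted map is determined by its values at the images of positive positions.
  Halving them forgets only their parity, which is that of \<open>K\<close>.\<close>

lemma bij_betw_chains:
  assumes \<pi>: "\<pi> \<in> hyperoctahedral n"
  shows "bij_betw (\<lambda>f i. if i \<le> n then f (\<pi> (int i)) div 2 else 0)
    (sorted_maps n \<pi> K) (chains n (gap \<pi> K) (int K div 2))"
    (is "bij_betw ?\<Phi> ?A ?B")
proof (rule bij_betw_imageI)
  note p = hyperoctahedral_permutes[OF \<pi>]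
  have grid: "f (\<pi> (int i)) \<in> grid K" if "f \<in> odd_maps n K" "0 < i" "i \<le> n" for f i
    using that hyperoctahedral_abs_le_iff[OF \<pi>] hyperoctahedral_eq_0_iff[OF \<pi>]
    by (intro odd_maps_grid) auto
  show "inj_on ?\<Phi> ?A"
  proof (rule inj_onI)
    fix f g assume "f \<in> ?A" "g \<in> ?A" and eq: "?\<Phi> f = ?\<Phi> g"
    then have fg: "f \<in> odd_maps n K" "g \<in> odd_maps n K" by (auto simp: sorted_maps_def)
    have pos: "f (\<pi> (int i)) = g (\<pi> (int i))" if "0 < i" "i \<le> n" for i
    proof -
      have "even (f (\<pi> (int i)) - int K)" "even (g (\<pi> (int i)) - int K)"
        using grid[OF fg(1) that] grid[OF fg(2) that] by (simp_all add: grid_def)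
      moreover have "f (\<pi> (int i)) div 2 = g (\<pi> (int i)) div 2"
        using fun_cong[OF eq, of i] that by simp
      ultimately show ?thesis by presburger
    qed
    have "f (\<pi> x) = g (\<pi> x)" for x
    proof -
      consider "x = 0" | "\<bar>x\<bar> > int n" | "0 < x" "x \<le> int n" | "0 < - x" "- x \<le> int n" by linarith
      then show ?thesis
      proof cases
        case 1
        then show ?thesis using hyperoctahedral_zero[OF \<pi>] odd_maps_zero fg by metis
      next
        case 2
        then show ?thesis
          using hyperoctahedral_abs_le_iff[OF \<pi>, of x] odd_maps_outside fg by (metis not_le)
      next
        case 3
        then show ?thesis using pos[of "nat x"] by simp
      next
        case 4
        then have "f (\<pi> (- x)) = g (\<pi> (- x))" using pos[of "nat (- x)"] by simp
        then show ?thesis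
          using hyperoctahedral_odd[OF \<pi>] odd_maps_uminus fg by (metis neg_equal_iff_equal)
      qed
    qed
    then show "f = g" using permutes_inverses(1)[OF p] by (metis ext)
  qed
  show "?\<Phi> ` ?A = ?B"
  proof
    show "?\<Phi> ` ?A \<subseteq> ?B"
    proof clarify
      fix f assume "f \<in> ?A"
      then have f: "f \<in> odd_maps n K" "sorts n \<pi> f" by (auto simp: sorted_maps_def)
      have "f (\<pi> (int n)) \<le> int K"
        using grid[OF f(1), of n] hyperoctahedral_zero[OF \<pi>] odd_maps_zero[OF f(1)]
        by (cases "n = 0") (auto simp: grid_def)
      then have "f (\<pi> (int n)) div 2 \<le> int K div 2" by (rule zdiv_mono1) simp
      moreover have "\<forall>i<n. f (\<pi> (int i)) div 2 + int (gap \<pi> K i) \<le> f (\<pi> (int (Suc i))) div 2"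
        using f(2) precedes_iff_gap[OF f(1) \<pi>] sorts_iff_steps[OF f(1) \<pi>] by blast
      ultimately show "?\<Phi> f \<in> ?B"
        using hyperoctahedral_zero[OF \<pi>] odd_maps_zero[OF f(1)] by (simp add: chains_def)
    qed
    show "?B \<subseteq> ?\<Phi> ` ?A"
    proof
      fix a assume a: "a \<in> ?B"
      define r where "r = int K mod 2"
      have K: "int K = 2 * (int K div 2) + r" and r: "0 \<le> r" by (simp_all add: r_def)
      \<comment> \<open>This undoes the halving: \<open>r\<close> restores the lost parity, and the
        values at negative positions are forced by oddness.\<close>
      define u where "u x = (if x = 0 \<or> \<bar>x\<bar> > int n then 0 else sgn x * (2 * a (nat \<bar>x\<bar>) + r))" for x
      have bnd: "0 \<le> a i" "a i \<le> int K div 2" if "i \<le> n" for i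
        using chains_sum_le[OF a that] chains_le[OF a that] by linarith+
      have "u x \<in> grid K" if "x \<noteq> 0" "\<bar>x\<bar> \<le> int n" for x
      proof -
        have "2 * a (nat \<bar>x\<bar>) + r \<in> grid K"
          using bnd[of "nat \<bar>x\<bar>"] that r unfolding grid_def
          by (subst (1 2) K) (auto simp: nat_le_iff)
        from this grid_uminus[OF this] show ?thesis using that by (auto simp: u_def sgn_if)
      qed
      then have u: "u \<in> odd_maps n K" by (auto simp: odd_maps_def u_def)
      define f where "f = u \<circ> inv \<pi>"
      have f: "f \<in> odd_maps n K"
        unfolding f_def by (rule odd_maps_comp[OF u inv_hyperoctahedral[OF \<pi>]])
      have fpi: "f (\<pi> x) = u x" for x using permutes_inverses(2)[OF p] by (simp add: f_def)
      have "r div 2 = 0" by (simp add: r_def)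
      then have half: "f (\<pi> (int i)) div 2 = a i" if "i \<le> n" for i
        using that a by (auto simp: fpi u_def chains_def)
      have "sorts n \<pi> f"
        unfolding sorts_iff_steps[OF f \<pi>] using a half
        by (auto simp: precedes_iff_gap[OF f \<pi>] chains_def simp del: of_nat_Suc)
      with f have "f \<in> ?A" by (simp add: sorted_maps_def)
      moreover have "a = ?\<Phi> f" using half a by (auto simp: fun_eq_iff chains_def)
      ultimately show "a \<in> ?\<Phi> ` ?A" by blast
    qed
  qed
qed

section \<open>Gap totals and descent numbers\<close>

definition des0 :: "(int \<Rightarrow> int) \<Rightarrow> nat" where
  "des0 \<pi> = of_bool (\<pi> 0 > \<pi> 1)"

lemma card_int_interval_eq_sum:
  "card {i \<in> {0..int n - 1}. P i} = (\<Sum>i<n. of_bool (P (int i)))"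
proof -
  have "{i \<in> {0..int n - 1}. P i} = int ` ({..<n} \<inter> {i. P (int i)})"
  proof
    show "{i \<in> {0..int n - 1}. P i} \<subseteq> int ` ({..<n} \<inter> {i. P (int i)})"
    proof
      fix i assume "i \<in> {i \<in> {0..int n - 1}. P i}"
      then show "i \<in> int ` ({..<n} \<inter> {i. P (int i)})" by (intro image_eqI[of _ _ "nat i"]) auto
    qed
  qed auto
  then show ?thesis by (simp add: card_image)
qed

lemma sum_gap_even:
  assumes "even K"
  shows "(\<Sum>i<n. gap \<pi> K i) = des_B n \<pi>"
  using assms card_int_interval_eq_sum[of n "\<lambda>i. \<pi> i > \<pi> (i + 1)"]
  by (simp add: des_B_def gap_def add.commute)

lemma sum_gap_odd:
  assumes "odd K"
  shows "(\<Sum>i<n. gap \<pi> K i) = des_A n \<pi>"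
proof -
  have "{i \<in> {1..int n - 1}. \<pi> i > \<pi> (i + 1)} = {i \<in> {0..int n - 1}. \<pi> i > \<pi> (i + 1) \<and> 0 < i}"
    by auto
  then show ?thesis
    using assms card_int_interval_eq_sum[of n "\<lambda>i. \<pi> i > \<pi> (i + 1) \<and> 0 < i"]
    by (simp add: des_A_def gap_def add.commute)
qed

lemma des_B_eq:
  assumes "n \<ge> 1"
  shows "des_B n \<pi> = des_A n \<pi> + des0 \<pi>"
proof -
  have "{i \<in> {0..int n - 1}. \<pi> i > \<pi> (i + 1)}
      = {i \<in> {1..int n - 1}. \<pi> i > \<pi> (i + 1)} \<union> (if \<pi> 0 > \<pi> 1 then {0} else {})"
    using assms by (force simp: le_less)
  moreover have "finite {i \<in> {1..int n - 1}. \<pi> i > \<pi> (i + 1)}"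
    by (rule finite_subset[of _ "{1..int n - 1}"]) auto
  ultimately show ?thesis by (simp add: des_A_def des_B_def des0_def)
qed

text \<open>This keeps the upper entry of the binomial coefficient in the theorem nonnegative, as a
  generalized binomial coefficient need not vanish at a negative upper entry.\<close>

lemma fdes_le: "fdes n \<pi> \<le> 2 * n"
proof -
  have "des_A n \<pi> \<le> card {1..int n - 1}" "des_B n \<pi> \<le> card {0..int n - 1}"
    unfolding des_A_def des_B_def by (rule card_mono; blast | simp)+
  then show ?thesis by (simp add: fdes_def)
qed

lemma card_sorted_maps:
  assumes n: "n \<ge> 1" and \<pi>: "\<pi> \<in> hyperoctahedral n"
  shows "card (sorted_maps n \<pi> K)
    = (if fdes n \<pi> \<le> K then (K - fdes n \<pi>) div 2 + n choose n else 0)"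
proof -
  define D where "D = (\<Sum>i<n. gap \<pi> K i)"
  have card: "card (sorted_maps n \<pi> K) = card (chains n (gap \<pi> K) (int (K div 2)))"
    using bij_betw_same_card[OF bij_betw_chains[OF \<pi>, of K]] by (simp add: zdiv_int)
  have fdes: "fdes n \<pi> = 2 * des_A n \<pi> + des0 \<pi>" "des0 \<pi> \<le> 1"
    using des_B_eq[OF n, of \<pi>] by (simp_all add: fdes_def des0_def)
  have D: "D = des_A n \<pi> + (if even K then des0 \<pi> else 0)"
    using sum_gap_even[of K \<pi> n] sum_gap_odd[of K \<pi> n] des_B_eq[OF n, of \<pi>]
    by (simp add: D_def)
  \<comment> \<open>Since \<open>fdes n \<pi>\<close> is
    \<open>2 * des_A n \<pi> + des0 \<pi>\<close>, a descent at 0 lowers the halved difference by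
    one for even \<open>K\<close> and is absorbed by rounding for odd \<open>K\<close>, matching the
    gap total \<open>D\<close>.\<close>
  have iff_diff: "(fdes n \<pi> \<le> K \<longleftrightarrow> D \<le> K div 2) \<and> K div 2 - D = (K - fdes n \<pi>) div 2"
  proof -
    have e: "des0 \<pi> = 0 \<or> des0 \<pi> = 1" using fdes(2) by linarith
    show ?thesis
    proof (cases "even K")
      case True
      then obtain q where "K = 2 * q" by (elim evenE)
      then show ?thesis using e unfolding fdes(1) D by (cases q) auto
    next
      case False
      then obtain q where "K = 2 * q + 1" by (elim oddE)
      then show ?thesis using e unfolding fdes(1) D by auto
    qed
  qed
  show ?thesis
  proof (cases "D \<le> K div 2")
    case True
    then have "int (K div 2) = int D + int (K div 2 - D)" by simp
    then have "card (sorted_maps n \<pi> K) = (K div 2 - D + n choose n)"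
      using card card_chains[of n "gap \<pi> K" "K div 2 - D"] by (simp add: D_def)
    then show ?thesis using True iff_diff by simp
  next
    case False
    then have "chains n (gap \<pi> K) (int (K div 2)) = {}"
      by (intro chains_empty) (simp add: D_def not_le del: of_nat_sum)
    then show ?thesis using card False iff_diff by simp
  qed
qed

lemma finite_sorted_maps:
  assumes "\<pi> \<in> hyperoctahedral n"
  shows "finite (sorted_maps n \<pi> K)"
proof -
  have "finite (chains n (gap \<pi> K) (int K div 2))"
  proof (cases "int K div 2 < int (\<Sum>i<n. gap \<pi> K i)")
    case True
    then show ?thesis by (simp add: chains_empty)
  next
    case False
    then show ?thesis
      using card_chains[of n "gap \<pi> K" "nat (int K div 2 - int (\<Sum>i<n. gap \<pi> K i))"] by simp
  qed
  then show ?thesis using bij_betw_finite[OF bij_betw_chains[OF assms, of K]] by simp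
qed

lemma card_sorted_maps_factorizations:
  assumes "\<pi> \<in> hyperoctahedral n"
  shows "card (sorted_maps n \<pi> ((j + 1) * (k + 1) - 1))
    = (\<Sum>(\<sigma>, \<tau>)\<in>factorizations n \<pi>. card (sorted_maps n \<sigma> j) * card (sorted_maps n \<tau> k))"
proof -
  have fin: "finite (factorizations n \<pi>)"
    by (rule finite_subset[of _ "hyperoctahedral n \<times> hyperoctahedral n"])
      (auto simp: factorizations_def finite_hyperoctahedral)
  have "card (sorted_maps n \<pi> ((j + 1) * (k + 1) - 1))
    = card (SIGMA (\<sigma>, \<tau>):factorizations n \<pi>. sorted_maps n \<sigma> j \<times> sorted_maps n \<tau> k)"
    using bij_betw_same_card[OF bij_betw_sorted_maps[OF assms]] by simp
  also have "\<dots> = (\<Sum>p\<in>factorizations n \<pi>.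
      card (case p of (\<sigma>, \<tau>) \<Rightarrow> sorted_maps n \<sigma> j \<times> sorted_maps n \<tau> k))"
    using fin by (intro card_SigmaI) (auto simp: factorizations_def finite_sorted_maps)
  also have "\<dots> = (\<Sum>(\<sigma>, \<tau>)\<in>factorizations n \<pi>.
      card (sorted_maps n \<sigma> j) * card (sorted_maps n \<tau> k))"
    by (rule sum.cong) (auto simp: card_cartesian_product)
  finally show ?thesis .
qed

section \<open>Generating functions\<close>

text \<open>Multiplying by \<open>1 - fps_X\<^sup>2\<close> takes differences at distance two, which
  lower \<open>j div 2\<close> by one; Pascal's rule then reduces \<open>Suc n\<close> to
  \<open>n\<close>. The base case is the geometric series.\<close>

lemma fps_binomial_div2:
  "Abs_fps (\<lambda>j. of_nat (j div 2 + n choose n)) * ((1 - fps_X) * (1 - fps_X\<^sup>2) ^ n) = (1 :: rat fps)"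
proof (induction n)
  case 0
  have "Abs_fps (\<lambda>j. 1) * (1 - fps_X) = (1 :: rat fps)"
    by (rule fps_ext) (simp add: algebra_simps)
  then show ?case by simp
next
  case (Suc n)
  let ?V = "\<lambda>n. Abs_fps (\<lambda>j. of_nat (j div 2 + n choose n)) :: rat fps"
  have "?V (Suc n) * (1 - fps_X\<^sup>2) = ?V n"
  proof (rule fps_ext)
    fix j
    have "j div 2 = Suc ((j - 2) div 2)" if "\<not> j < 2" using that by presburger
    then show "fps_nth (?V (Suc n) * (1 - fps_X\<^sup>2)) j = fps_nth (?V n) j"
      by (cases "j < 2") (auto simp: right_diff_distrib fps_X_power_mult_right_nth)
  qed
  moreover have "a * (b * (c * d)) = a * c * (b * d)" for a b c d :: "rat fps"
    by (simp add: mult_ac)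
  ultimately show ?case using Suc by (simp only: power_Suc)
qed

lemma fps_card_sorted_maps:
  assumes "n \<ge> 1" "\<pi> \<in> hyperoctahedral n"
  shows "Abs_fps (\<lambda>K. of_nat (card (sorted_maps n \<pi> K))) * ((1 - fps_X) * (1 - fps_X\<^sup>2) ^ n)
    = (fps_X ^ fdes n \<pi> :: rat fps)"
proof -
  have "Abs_fps (\<lambda>K. of_nat (card (sorted_maps n \<pi> K)))
      = fps_X ^ fdes n \<pi> * Abs_fps (\<lambda>j. of_nat (j div 2 + n choose n) :: rat)"
    by (rule fps_ext) (simp add: fps_X_power_mult_nth card_sorted_maps[OF assms])
  then show ?thesis using fps_binomial_div2[of n] by (simp add: mult.assoc)
qed

text \<open>\<open>fps_const\<close> embeds \<open>\<rat>[[s]]\<close> and \<open>map_const\<close> embeds \<open>\<rat>[[t]]\<close> into \<open>\<rat>[[s]][[t]]\<close>.\<close>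

definition map_const :: "rat fps \<Rightarrow> rat fps fps" where
  "map_const f = Abs_fps (\<lambda>k. fps_const (fps_nth f k))"

lemma map_const_mult: "map_const (f * g) = map_const f * map_const g"
proof (rule fps_ext)
  fix k
  have "fps_const (\<Sum>i\<in>A. h i) = (\<Sum>i\<in>A. fps_const (h i))" for h :: "nat \<Rightarrow> rat" and A
    by (induction A rule: infinite_finite_induct) (simp_all flip: fps_const_add)
  then show "fps_nth (map_const (f * g)) k = fps_nth (map_const f * map_const g) k"
    by (simp add: map_const_def fps_mult_nth)
qed

lemma map_const_diff: "map_const (f - g) = map_const f - map_const g"
  by (rule fps_ext) (simp add: map_const_def)

lemma map_const_1: "map_const 1 = 1"
  by (rule fps_ext) (simp add: map_const_def)

lemma map_const_X: "map_const fps_X = fps_t"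
  by (rule fps_ext) (simp add: map_const_def fps_t_def)

lemma map_const_power: "map_const (f ^ m) = map_const f ^ m"
  by (induction m) (simp_all add: map_const_1 map_const_mult)

lemma fps2_times: "fps2 (\<lambda>j k. a j * b k) = fps_const (Abs_fps a) * map_const (Abs_fps b)"
  by (intro fps_ext) (simp add: fps2_def map_const_def)

lemma fps2_sum: "fps2 (\<lambda>j k. \<Sum>p\<in>A. a p j k) = (\<Sum>p\<in>A. fps2 (a p))"
  by (intro fps_ext) (simp add: fps2_def fps_sum_nth)

section \<open>The binomial coefficient of the theorem as a count\<close>

lemma ceiling_half_of_int: "\<lceil>(1 / 2) * rat_of_int z\<rceil> = (z + 1) div 2"
proof (cases "even z")
  case True
  then obtain w where "z = 2 * w" by (elim evenE)
  then show ?thesis by simp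
next
  case False
  then obtain w where w: "z = 2 * w + 1" by (elim oddE)
  have "\<lceil>(1 / 2) * rat_of_int z\<rceil> = w + 1"
    by (rule ceiling_unique) (simp_all add: w)
  then show ?thesis using w by simp
qed

lemma gchoose_eq_card_sorted_maps:
  assumes "n \<ge> 1" "\<pi> \<in> hyperoctahedral n"
  shows "(rat_of_int (\<lceil>(1 / 2 :: rat) * (of_nat j * of_nat k + of_nat j + of_nat k - 1
      - of_nat (fdes n \<pi>))\<rceil> + int n) gchoose n)
    = of_nat (card (sorted_maps n \<pi> ((j + 1) * (k + 1) - 1)))"
proof -
  define K where "K = (j + 1) * (k + 1) - 1"
  have "(of_nat j * of_nat k + of_nat j + of_nat k - 1 - of_nat (fdes n \<pi>) :: rat)
      = rat_of_int (int K - 1 - int (fdes n \<pi>))"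
    by (simp add: K_def algebra_simps)
  note eq = this
  \<comment> \<open>The -1 under the ceiling cancels the +1 that arises on rewriting the ceiling as
    a floor.\<close>
  have c: "\<lceil>(1 / 2 :: rat) * (of_nat j * of_nat k + of_nat j + of_nat k - 1
      - of_nat (fdes n \<pi>))\<rceil> = (int K - int (fdes n \<pi>)) div 2"
    unfolding eq ceiling_half_of_int by simp
  show ?thesis
  proof (cases "fdes n \<pi> \<le> K")
    case True
    then have eq: "(int K - int (fdes n \<pi>)) div 2 + int n = int ((K - fdes n \<pi>) div 2 + n)"
      by (simp add: zdiv_int of_nat_diff)
    show ?thesis
      unfolding c eq K_def[symmetric] using True card_sorted_maps[OF assms, of K]
      by (simp add: binomial_gbinomial del: of_nat_add)
  next
    case False
    \<comment> \<open>Here the count is 0, and the upper entry \<open>p\<close> lies between 0 and n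
      - 1, so the binomial coefficient vanishes too.\<close>
    define p where "p = nat ((int K - int (fdes n \<pi>)) div 2 + int n)"
    have "- int n \<le> (int K - int (fdes n \<pi>)) div 2"
      using fdes_le[of n \<pi>] by presburger
    moreover have "(int K - int (fdes n \<pi>)) div 2 < 0" using False by presburger
    ultimately have eq: "(int K - int (fdes n \<pi>)) div 2 + int n = int p" and p: "p < n"
      by (auto simp: p_def)
    show ?thesis
      unfolding c eq K_def[symmetric] using p False card_sorted_maps[OF assms, of K]
      by (simp flip: binomial_gbinomial)
  qed
qed

theorem theorem2p6p4:
  fixes n :: nat and \<pi> :: "int \<Rightarrow> int"
  assumes "n \<ge> 1" and "\<pi> \<in> hyperoctahedral n"
  shows "fps2 (\<lambda>j k.
           rat_of_int (\<lceil>(1 / 2 :: rat) * (of_nat j * of_nat k + of_nat j + of_nat k - 1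
                                          - of_nat (fdes n \<pi>))\<rceil> + int n) gchoose n)
       = F_series n \<pi>
         / ((1 - fps_s) * (1 - fps_s\<^sup>2) ^ n * (1 - fps_t) * (1 - fps_t\<^sup>2) ^ n)"
    (is "?A = _ / ?D")
proof -
  define W where "W \<sigma> = Abs_fps (\<lambda>K. rat_of_nat (card (sorted_maps n \<sigma> K)))" for \<sigma>
  define E :: "rat fps" where "E = (1 - fps_X) * (1 - fps_X\<^sup>2) ^ n"
  have "?A = fps2 (\<lambda>j k. \<Sum>p\<in>factorizations n \<pi>.
      of_nat (card (sorted_maps n (fst p) j)) * of_nat (card (sorted_maps n (snd p) k)))"
    unfolding gchoose_eq_card_sorted_maps[OF assms]
      card_sorted_maps_factorizations[OF assms(2)]
    by (simp add: case_prod_unfold)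
  also have "\<dots> = (\<Sum>p\<in>factorizations n \<pi>. fps_const (W (fst p)) * map_const (W (snd p)))"
    by (simp add: fps2_sum fps2_times W_def)
  finally have A: "?A = \<dots>" .
  \<comment> \<open>The denominator separates into the same one-variable series \<open>E\<close> in
    s and in t, so each factor clears its own generating function.\<close>
  have D: "?D = fps_const E * map_const E"
    by (simp add: E_def map_const_mult map_const_diff map_const_1 map_const_power map_const_X
        fps_s_def mult.assoc flip: fps_const_mult fps_const_sub fps_const_power)
  have "?A * ?D = (\<Sum>p\<in>factorizations n \<pi>.
      fps_const (W (fst p) * E) * map_const (W (snd p) * E))"
    unfolding A D sum_distrib_right
    by (intro sum.cong refl) (simp add: map_const_mult mult_ac flip: fps_const_mult)
  also have "\<dots> = F_series n \<pi>"
    unfolding F_series_def factorizations_def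
    by (intro sum.cong refl)
      (auto simp: W_def E_def fps_card_sorted_maps[OF assms(1)] map_const_power map_const_X
        fps_s_def fps_const_power)
  finally have AD: "?A * ?D = F_series n \<pi>" .
  \<comment> \<open>The constant term is 1, so the division is genuine and both sides can be
    compared after multiplication by the denominator.\<close>
  have nz: "fps_nth (fps_nth ?D 0) 0 \<noteq> 0"
    unfolding D by (simp add: E_def map_const_def fps_mult_nth fps_power_zeroth)
  then have cancel: "F_series n \<pi> / ?D * ?D = ?A * ?D"
    using fps2_divide_mult_cancel AD by simp
  have nonzero: "?D \<noteq> 0"
  proof
    assume "?D = 0"
    with nz show False by (simp only: fps_zero_nth)
  qed
  show ?thesis by (rule sym[OF iffD1[OF mult_right_cancel[OF nonzero] cancel]])
qed

end
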